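(* Let $0<s<1$ and let $\Omega\subset\mathbb{R}^n$ be an open set, possibly unbounded and disconnected. Assume that there is a constant $c_0>0$ such that for any $\tilde x\in\mathbb{R}^n$, $$\liminf_{R\to+\infty}\frac{|B_R(\tilde x)\cap\Omega^c|}{|B_R(\tilde x)|}\ge c_0.$$ Let $u\in\mathcal{L}_{2s}\cap C^2(\Omega)$ be bounded from above and satisfy, for some nonnegative function $c(x)$, $$\begin{cases}(-\Delta)^s u(x)-\Delta u(x)+c(x)u(x)\le 0, & \text{at the points } x\in\Omega \text{ where } u(x)>0,\\ u(x)\le 0, & x\in\Omega^c.\end{cases}$$ Then $u(x)\le 0$ for all $x\in\Omega$.
   Context: $\Omega^c=\mathbb{R}^n\setminus\Omega$, $B_R(x)$ is the open ball of radius $R$ centered at $x$, and $|\cdot|$ of a set is Lebesgue measure. The space $\mathcal{L}_{2s}$ is $$\mathcal{L}_{2s}=\Big\{u\in L^1_{loc}(\mathbb{R}^n)\ \Big|\ \int_{\mathbb{R}^n}\frac{|u(x)|}{1+|x|^{n+2s}}\,dx<+\infty\Big\}.$$ The fractional Laplacian is $$(-\Delta)^s u(x)=C_{n,s}\,\mathrm{P.V.}\int_{\mathbb{R}^n}\frac{u(x)-u(y)}{|x-y|^{n+2s}}\,dy=C_{n,s}\lim_{\epsilon\to0}\int_{\mathbb{R}^n\setminus B_\epsilon(x)}\frac{u(x)-u(y)}{|x-y|^{n+2s}}\,dy,$$ where $C_{n,s}>0$ is the usual normalization constant. $\Delta$ is the classical Laplacian.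
   Formalization: The formal theorem additionally assumes that the limsup of u(x), as x in Ω tends to any boundary point of Ω, is at most 0 (automatic if u is upper semicontinuous on the closure of Ω); without it the claim fails for u jumping at the boundary. *)

theory Defs
  imports "HOL-Analysis.Analysis"
begin

text \<open>Local integrability is integrability on every compact set. As usual for Lebesgue spaces,
  measurability is with respect to the completed measure \<^const>\<open>lebesgue\<close>.\<close>

definition L1_loc :: "(real ^ 'n \<Rightarrow> real) set" where
  "L1_loc = {u. \<forall>K. compact K \<longrightarrow> u absolutely_integrable_on K}"

definition L_2s :: "real \<Rightarrow> (real ^ 'n \<Rightarrow> real) set" where
  "L_2s s = {u \<in> L1_loc.
     integrable lebesgue (\<lambda>x. \<bar>u x\<bar> / (1 + norm x powr (real CARD('n) + 2 * s)))}"

text \<open>The normalization for which the operator has Fourier symbol \<open>|\<xi>| powr (2 * s)\<close>.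
  The usual form \<open>4 powr s * \<Gamma>(n/2 + s) / (\<pi> powr (n/2) * |\<Gamma>(-s)|)\<close> is rewritten by
  \<open>|\<Gamma>(-s)| = \<Gamma>(1 - s) / s\<close>, for \<open>0 < s < 1\<close>.\<close>

definition frac_const :: "nat \<Rightarrow> real \<Rightarrow> real" where
  "frac_const n s =
     s * 4 powr s * Gamma (real n / 2 + s) / (pi powr (real n / 2) * Gamma (1 - s))"

text \<open>The principal value is the \<^const>\<open>Lim\<close> of truncated Lebesgue integrals, so it is an unspecified
  real number where it does not exist. It exists at every point near which \<open>u\<close> is \<open>C\<^sup>2\<close>, for
  \<open>u\<close> in \<^term>\<open>L_2s s\<close>.\<close>

definition frac_laplacian :: "real \<Rightarrow> (real ^ 'n \<Rightarrow> real) \<Rightarrow> real ^ 'n \<Rightarrow> real" where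
  "frac_laplacian s u x =
     frac_const CARD('n) s *
     Lim (at_right 0) (\<lambda>\<epsilon>. set_lebesgue_integral lebesgue (- ball x \<epsilon>)
        (\<lambda>y. (u x - u y) / norm (x - y) powr (real CARD('n) + 2 * s)))"

definition partial_deriv :: "'n \<Rightarrow> (real ^ 'n \<Rightarrow> real) \<Rightarrow> real ^ 'n \<Rightarrow> real" where
  "partial_deriv i u x = deriv (\<lambda>t. u (x + t *\<^sub>R axis i 1)) 0"

definition laplacian :: "(real ^ 'n \<Rightarrow> real) \<Rightarrow> real ^ 'n \<Rightarrow> real" where
  "laplacian u x = (\<Sum>i\<in>UNIV. partial_deriv i (partial_deriv i u) x)"

text \<open>Twice continuously differentiable on an open set, with first and second Frechet
  derivatives; continuity of the first one follows from its differentiability.\<close>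

definition C2_on :: "(real ^ 'n) set \<Rightarrow> (real ^ 'n \<Rightarrow> real) set" where
  "C2_on S = {u. \<exists>(Du :: real ^ 'n \<Rightarrow> (real ^ 'n) \<Rightarrow>\<^sub>L real)
                  (D2u :: real ^ 'n \<Rightarrow> (real ^ 'n) \<Rightarrow>\<^sub>L (real ^ 'n) \<Rightarrow>\<^sub>L real).
     (\<forall>x\<in>S. (u has_derivative blinfun_apply (Du x)) (at x)) \<and>
     (\<forall>x\<in>S. (Du has_derivative blinfun_apply (D2u x)) (at x)) \<and>
     continuous_on S D2u}"

end

theory Submission
  imports Defs
begin

text \<open>Suppose that \<open>M = sup u\<close> is positive. Since \<open>\<Omega>\<close> may be unbounded, \<open>M\<close> is perhaps not attained, so a small
bump is added to force an interior maximum. Pick \<open>x0\<close> with \<open>u x0 > M - a\<close>, where \<open>a = \<delta> * M\<close>, and consider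
\<open>u + a * \<phi>\<close> for the truncated paraboloid \<open>\<phi> y = max 0 (1 - |y - x0|\<^sup>2 / R\<^sup>2)\<close>. This function exceeds \<open>M\<close> at \<open>x0\<close>
but not outside \<open>ball x0 R\<close> and not where \<open>u\<close> is small, so it has a global maximum at some \<open>x \<in> \<Omega>\<close>
with \<open>|x - x0| < R\<close> and \<open>u x \<ge> M - a\<close> (\<open>bump_perturbation_attains_max\<close>). The maximum says that \<open>u\<close> lies
below a paraboloid of opening \<open>a / R\<^sup>2\<close> which touches it at \<open>x\<close>. Everything follows from this one inequality.

The Laplacian of \<open>u\<close> at \<open>x\<close> is at most a multiple of \<open>a / R\<^sup>2\<close>, hence of \<open>a * R powr (-2 * s)\<close> when \<open>R \<ge> 1\<close>
(\<open>laplacian_le_at_touching_paraboloid\<close>). The fractional Laplacian has two contributions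
(\<open>trunc_integral_lower_bound\<close>). The touching paraboloid costs at most a multiple of
\<open>a * R powr (-2 * s)\<close>. The points of \<open>- \<Omega>\<close> in \<open>ball x0 R\<close> gain: there \<open>u\<close> is nonpositive while \<open>u x\<close> is
almost \<open>M\<close>, and if \<open>R\<close> is large they fill a fixed fraction of the ball, which yields a multiple of
\<open>M * R powr (-2 * s)\<close> with a factor independent of \<open>\<delta>\<close>. The radius \<open>R\<close> from the density condition depends
on \<open>x0\<close>, but it enters all three bounds through the same power, so it cancels. For small \<open>\<delta>\<close>
the gain wins and the differential inequality fails at \<open>x\<close>.

The constants come from integrals of powers of the distance over a ball and over its complement, which
are estimated by dyadic annuli. The principal value is the limit of truncated integrals; it exists because,
by oddness, a linear term may be added to the numerator on a ball at no cost
(\<open>trunc_integral_add_linear\<close>), and then the integrand is absolutely integrable.\<close>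

section \<open>Integrals of powers of the distance\<close>

lemma dyadic_scale:
  fixes r :: real
  assumes "1 \<le> r"
  obtains k :: nat where "2 ^ k \<le> r" "r \<le> 2 * 2 ^ k"
proof -
  define k where "k = nat \<lfloor>log 2 r\<rfloor>"
  have "0 \<le> log 2 r" using assms by simp
  then have "real k \<le> log 2 r" "log 2 r \<le> real (Suc k)"
    unfolding k_def by linarith+
  then have "2 powr real k \<le> r" "r \<le> 2 powr real (Suc k)"
    using assms by (simp_all add: le_log_iff log_le_iff del: of_nat_Suc)
  then show thesis
    using that[of k] by (simp add: powr_realpow del: of_nat_Suc)
qed

lemma powr_le_on_dyadic_annulus:
  fixes t r p :: real
  assumes "0 < t" "t \<le> r" "r \<le> 2 * t"
  shows "r powr p \<le> max 1 (2 powr p) * t powr p"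
proof (cases "0 \<le> p")
  case True
  have "r powr p \<le> (2 * t) powr p" using assms True by (intro powr_mono2) auto
  also have "\<dots> = 2 powr p * t powr p" using assms by (simp add: powr_mult)
  also have "\<dots> \<le> max 1 (2 powr p) * t powr p" by (intro mult_right_mono) auto
  finally show ?thesis .
next
  case False
  have "r powr p \<le> t powr p" using assms False by (intro powr_mono2') auto
  also have "\<dots> \<le> max 1 (2 powr p) * t powr p" by (simp add: mult_le_cancel_right1)
  finally show ?thesis .
qed

lemma nn_integral_suminf_cmult_indicator:
  fixes C :: "nat \<Rightarrow> 'a set"
  assumes "\<And>k. C k \<in> sets M"
  shows "(\<integral>\<^sup>+y. (\<Sum>k. a k * indicator (C k) y) \<partial>M) = (\<Sum>k. a k * emeasure M (C k))"
  using assms by (subst nn_integral_suminf) (auto simp: nn_integral_cmult_indicator)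

text \<open>On an annulus of radii \<open>\<tau>\<close> and \<open>2 * \<tau>\<close> the power of the distance is comparable to \<open>\<tau> powr p\<close>, and its volume is
at most a multiple of \<open>\<tau> ^ DIM('a)\<close>. The integrals over the annuli of radii \<open>t * \<sigma> ^ k\<close> are therefore dominated by a
geometric series. Taking \<open>\<sigma> < 1\<close> covers a ball and \<open>\<sigma> > 1\<close> covers the complement of a ball.\<close>

lemma nn_integral_norm_powr_dyadic:
  fixes x :: "'a::euclidean_space" and p t \<sigma> :: real
  defines "q \<equiv> p + real DIM('a)"
  assumes t: "0 < t" and l: "0 < \<sigma>" and small: "\<sigma> powr q < 1"
    and cover: "\<And>y. y \<in> S \<Longrightarrow> \<exists>k::nat. t * \<sigma> ^ k \<le> norm (x - y) \<and> norm (x - y) \<le> 2 * (t * \<sigma> ^ k)"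
  shows "(\<integral>\<^sup>+y. ennreal (indicator S y * norm (x - y) powr p) \<partial>lborel)
     \<le> ennreal (max 1 (2 powr p) * (unit_ball_vol (real DIM('a)) * 2 ^ DIM('a)) / (1 - \<sigma> powr q) * t powr q)"
proof -
  define K where "K = max 1 (2 powr p)"
  define V where "V = unit_ball_vol (real DIM('a)) * 2 ^ DIM('a)"
  define \<tau> where "\<tau> k = t * \<sigma> ^ k" for k :: nat
  have K: "0 \<le> K" and V: "0 \<le> V" by (auto simp: K_def V_def)
  have \<tau>: "0 < \<tau> k" for k using t l by (simp add: \<tau>_def)
  have \<tau>q: "\<tau> k powr q = t powr q * (\<sigma> powr q) ^ k" for k
    using t l by (simp add: \<tau>_def powr_mult powr_realpow[symmetric] powr_powr mult.commute)
  have "(\<integral>\<^sup>+y. ennreal (indicator S y * norm (x - y) powr p) \<partial>lborel)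
      \<le> (\<integral>\<^sup>+y. (\<Sum>k. ennreal (K * \<tau> k powr p) * indicator (cball x (2 * \<tau> k)) y) \<partial>lborel)"
  proof (rule nn_integral_mono)
    fix y :: 'a
    show "ennreal (indicator S y * norm (x - y) powr p)
        \<le> (\<Sum>k. ennreal (K * \<tau> k powr p) * indicator (cball x (2 * \<tau> k)) y)"
    proof (cases "y \<in> S")
      case True
      then obtain k where k: "\<tau> k \<le> norm (x - y)" "norm (x - y) \<le> 2 * \<tau> k"
        using cover unfolding \<tau>_def by blast
      have "ennreal (indicator S y * norm (x - y) powr p) \<le> ennreal (K * \<tau> k powr p)"
        using True powr_le_on_dyadic_annulus[OF \<tau> k, of p] by (intro ennreal_leI) (auto simp: K_def)
      also have "\<dots> = (\<Sum>j\<in>{k}. ennreal (K * \<tau> j powr p) * indicator (cball x (2 * \<tau> j)) y)"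
        using k by (simp add: dist_norm)
      also have "\<dots> \<le> (\<Sum>k. ennreal (K * \<tau> k powr p) * indicator (cball x (2 * \<tau> k)) y)"
        by (rule sum_le_suminf) auto
      finally show ?thesis .
    qed auto
  qed
  also have "\<dots> = (\<Sum>k. ennreal (K * \<tau> k powr p) * emeasure lborel (cball x (2 * \<tau> k)))"
    by (rule nn_integral_suminf_cmult_indicator) simp
  also have "\<dots> = (\<Sum>k. ennreal (K * V * t powr q * (\<sigma> powr q) ^ k))"
  proof (rule suminf_cong)
    fix k
    have "ennreal (K * \<tau> k powr p) * emeasure lborel (cball x (2 * \<tau> k))
       = ennreal (K * \<tau> k powr p) * ennreal (unit_ball_vol (real DIM('a)) * (2 * \<tau> k) ^ DIM('a))"
      using \<tau>[of k] by (simp add: emeasure_cball)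
    also have "\<dots> = ennreal (K * V * (\<tau> k powr p * \<tau> k ^ DIM('a)))"
      using K V \<tau>[of k] by (subst ennreal_mult'[symmetric]) (auto simp: V_def power_mult_distrib mult_ac)
    also have "\<tau> k powr p * \<tau> k ^ DIM('a) = \<tau> k powr q"
      using \<tau>[of k] by (simp add: q_def powr_add powr_realpow)
    finally show "ennreal (K * \<tau> k powr p) * emeasure lborel (cball x (2 * \<tau> k))
        = ennreal (K * V * t powr q * (\<sigma> powr q) ^ k)"
      by (simp add: \<tau>q mult_ac)
  qed
  also have "\<dots> = ennreal (K * V * t powr q * (1 / (1 - \<sigma> powr q)))"
  proof (rule suminf_ennreal_eq)
    show "(\<lambda>k. K * V * t powr q * (\<sigma> powr q) ^ k) sums (K * V * t powr q * (1 / (1 - \<sigma> powr q)))"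
      using small by (intro sums_mult geometric_sums) auto
  qed (use K V in auto)
  finally show ?thesis by (simp add: K_def V_def mult_ac)
qed

lemma integrable_lebesgue_of_nn_integral:
  fixes f :: "'a::euclidean_space \<Rightarrow> real"
  assumes f: "f \<in> borel_measurable borel" "\<And>y. 0 \<le> f y"
    and b: "(\<integral>\<^sup>+y. ennreal (f y) \<partial>lborel) \<le> ennreal B" "0 \<le> B"
  shows "integrable lebesgue f" "integral\<^sup>L lebesgue f \<le> B"
proof -
  have "(\<integral>\<^sup>+y. ennreal (f y) \<partial>lborel) < \<infinity>"
    using b by (metis ennreal_less_top infinity_ennreal_def le_less_trans)
  then have i: "integrable lborel f" using f by (intro integrableI_nonneg) auto
  then show "integrable lebesgue f" using f(1) by (simp add: integrable_completion)
  have "ennreal (integral\<^sup>L lborel f) \<le> ennreal B"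
    using nn_integral_eq_integral[OF i] f(2) b(1) by simp
  then show "integral\<^sup>L lebesgue f \<le> B"
    using f(1) b(2) by (simp add: integral_completion)
qed

text \<open>The constant depends on the exponent and the dimension only. That the bound scales exactly like
\<open>\<rho> powr (p + DIM('a))\<close> is what later lets the radius cancel.\<close>

lemma norm_powr_integral_ball:
  assumes p: "0 < p + real DIM('a::euclidean_space)"
  obtains K where "0 \<le> K"
    "\<And>(x::'a) \<rho>. 0 < \<rho> \<Longrightarrow> integrable lebesgue (\<lambda>y. indicator (ball x \<rho>) y * norm (x - y) powr p)"
    "\<And>(x::'a) \<rho>. 0 < \<rho> \<Longrightarrow> (LINT y|lebesgue. indicator (ball x \<rho>) y * norm (x - y) powr p)
        \<le> K * \<rho> powr (p + real DIM('a))"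
proof -
  define q where "q = p + real DIM('a)"
  have q: "0 < q" and small: "(1/2::real) powr q < 1"
    using p powr01_less_one[of "1/2" q] by (auto simp: q_def)
  define C where "C = max 1 (2 powr p) * (unit_ball_vol (real DIM('a)) * 2 ^ DIM('a)) / (1 - (1/2) powr q)"
  have C: "0 \<le> C" using small by (simp add: C_def)
  have *: "(\<integral>\<^sup>+y. ennreal (indicator (ball x \<rho>) y * norm (x - y) powr p) \<partial>lborel)
      \<le> ennreal (C * (1/2) powr q * \<rho> powr q)" if \<rho>: "0 < \<rho>" for x :: 'a and \<rho>
  proof -
    \<comment> \<open>The centre lies in no annulus; it can be removed because \<open>0 powr p = 0\<close>.\<close>
    have "(\<integral>\<^sup>+y. ennreal (indicator (ball x \<rho>) y * norm (x - y) powr p) \<partial>lborel)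
      = (\<integral>\<^sup>+y. ennreal (indicator (ball x \<rho> - {x}) y * norm (x - y) powr p) \<partial>lborel)"
      by (intro nn_integral_cong) (auto simp: indicator_def)
    also have "\<dots> \<le> ennreal (C * (\<rho> / 2) powr q)"
      unfolding C_def q_def
    proof (rule nn_integral_norm_powr_dyadic)
      fix y assume "y \<in> ball x \<rho> - {x}"
      then have d: "0 < norm (x - y)" "norm (x - y) < \<rho>" by (auto simp: dist_norm)
      then have "1 \<le> \<rho> / norm (x - y)" by simp
      then obtain k where "2 ^ k \<le> \<rho> / norm (x - y)" "\<rho> / norm (x - y) \<le> 2 * 2 ^ k"
        by (rule dyadic_scale)
      then have "\<rho> / 2 * (1 / 2) ^ k \<le> norm (x - y)" "norm (x - y) \<le> 2 * (\<rho> / 2 * (1 / 2) ^ k)"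
        using d by (auto simp: field_simps)
      then show "\<exists>k. \<rho> / 2 * (1 / 2) ^ k \<le> norm (x - y) \<and> norm (x - y) \<le> 2 * (\<rho> / 2 * (1 / 2) ^ k)"
        by blast
    qed (use \<rho> small in \<open>auto simp: q_def\<close>)
    also have "(\<rho> / 2) powr q = (1/2) powr q * \<rho> powr q"
      using \<rho> powr_mult[of "1/2" \<rho> q] by (simp add: mult.commute)
    finally show ?thesis by (simp add: mult.assoc)
  qed
  have m: "(\<lambda>y. indicator (ball x \<rho>) y * norm (x - y) powr p) \<in> borel_measurable borel" for x :: 'a and \<rho>
    by (intro borel_measurable_times borel_measurable_indicator powr_real_measurable borel_measurable_norm
        borel_measurable_diff; simp)
  show thesis
    by (rule that[of "C * (1/2) powr q"])
      (use C integrable_lebesgue_of_nn_integral[OF m _ *] in \<open>auto simp: q_def\<close>)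
qed

lemma norm_powr_integral_outside_ball:
  assumes p: "p + real DIM('a::euclidean_space) < 0"
  obtains K where "0 \<le> K"
    "\<And>(x::'a) \<rho>. 0 < \<rho> \<Longrightarrow> integrable lebesgue (\<lambda>y. indicator (- ball x \<rho>) y * norm (x - y) powr p)"
    "\<And>(x::'a) \<rho>. 0 < \<rho> \<Longrightarrow> (LINT y|lebesgue. indicator (- ball x \<rho>) y * norm (x - y) powr p)
        \<le> K * \<rho> powr (p + real DIM('a))"
proof -
  define q where "q = p + real DIM('a)"
  have q: "q < 0" and small: "(2::real) powr q < 1"
    using p powr_less_mono[of q 0 2] by (auto simp: q_def)
  define C where "C = max 1 (2 powr p) * (unit_ball_vol (real DIM('a)) * 2 ^ DIM('a)) / (1 - 2 powr q)"
  have C: "0 \<le> C" using small by (simp add: C_def)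
  have *: "(\<integral>\<^sup>+y. ennreal (indicator (- ball x \<rho>) y * norm (x - y) powr p) \<partial>lborel)
      \<le> ennreal (C * \<rho> powr q)" if \<rho>: "0 < \<rho>" for x :: 'a and \<rho>
    unfolding C_def q_def
  proof (rule nn_integral_norm_powr_dyadic)
    fix y assume "y \<in> - ball x \<rho>"
    then have d: "\<rho> \<le> norm (x - y)" by (auto simp: dist_norm)
    then have "1 \<le> norm (x - y) / \<rho>" using \<rho> by simp
    then obtain k where "2 ^ k \<le> norm (x - y) / \<rho>" "norm (x - y) / \<rho> \<le> 2 * 2 ^ k"
      by (rule dyadic_scale)
    then have "\<rho> * 2 ^ k \<le> norm (x - y)" "norm (x - y) \<le> 2 * (\<rho> * 2 ^ k)"
      using \<rho> by (auto simp: field_simps)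
    then show "\<exists>k. \<rho> * 2 ^ k \<le> norm (x - y) \<and> norm (x - y) \<le> 2 * (\<rho> * 2 ^ k)"
      by blast
  qed (use \<rho> small in \<open>auto simp: q_def\<close>)
  have m: "(\<lambda>y. indicator (- ball x \<rho>) y * norm (x - y) powr p) \<in> borel_measurable borel" for x :: 'a and \<rho>
    by (intro borel_measurable_times borel_measurable_indicator powr_real_measurable borel_measurable_norm
        borel_measurable_diff; simp)
  show thesis
    by (rule that[of C])
      (use C integrable_lebesgue_of_nn_integral[OF m _ *] in \<open>auto simp: q_def\<close>)
qed

section \<open>Truncated singular integrals and the principal value\<close>

lemma integral_odd_about_eq_0:
  fixes f :: "'a::euclidean_space \<Rightarrow> real"
  assumes f: "f \<in> borel_measurable borel" and odd: "\<And>y. f (2 *\<^sub>R x - y) = - f y"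
  shows "integral\<^sup>L lebesgue f = 0"
proof -
  have "lborel = distr lborel borel (\<lambda>y. 2 *\<^sub>R x - y)"
    using lborel_affine[of "-1" "2 *\<^sub>R x :: 'a"] by (simp add: density_1)
  then have "integral\<^sup>L lborel f = integral\<^sup>L (distr lborel borel (\<lambda>y. 2 *\<^sub>R x - y)) f"
    by simp
  also have "\<dots> = (LINT y|lborel. f (2 *\<^sub>R x - y))"
    using f by (intro integral_distr) auto
  also have "\<dots> = - integral\<^sup>L lborel f" by (simp add: odd)
  finally show ?thesis using f by (simp add: integral_completion)
qed

lemma borel_measurable_L1_loc:
  assumes "u \<in> L1_loc"
  shows "u \<in> borel_measurable lebesgue"
proof (rule borel_measurable_LIMSEQ_real)
  show "(\<lambda>x. indicator (cball 0 (real k)) x * u x) \<in> borel_measurable lebesgue" for k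
    using assms absolutely_integrable_measurable unfolding L1_loc_def set_integrable_def
    by (auto dest!: spec[of _ "cball 0 (real k)"] borel_measurable_integrable)
  show "(\<lambda>k. indicator (cball 0 (real k)) x * u x) \<longlonglongrightarrow> u x" for x
  proof (rule tendsto_eventually)
    have "eventually (\<lambda>k. norm x \<le> real k) sequentially"
      using filterlim_real_sequentially by (auto simp: filterlim_at_top)
    then show "\<forall>\<^sub>F k in sequentially. indicator (cball 0 (real k)) x * u x = u x"
      by eventually_elim auto
  qed
qed

lemma borel_measurable_L_2s: "u \<in> L_2s s \<Longrightarrow> u \<in> borel_measurable lebesgue"
  by (simp add: L_2s_def borel_measurable_L1_loc)

lemma borel_measurable_norm_powr:
  "(\<lambda>y::'a::euclidean_space. norm (x - y) powr p) \<in> borel_measurable borel"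
  by measurable

lemma lebesgue_measurable_norm_powr:
  "(\<lambda>y::'a::euclidean_space. norm (x - y) powr p) \<in> borel_measurable lebesgue"
  by (intro measurable_completion) (simp add: borel_measurable_norm_powr)

text \<open>Away from \<open>x\<close> the kernel is bounded by a multiple of the weight that defines \<open>L_2s s\<close>, because there
both \<open>1\<close> and \<open>norm y\<close> are at most a constant times the distance to \<open>x\<close>.\<close>

lemma integrable_L_2s_div_norm_powr:
  fixes u :: "real ^ 'n \<Rightarrow> real"
  assumes u: "u \<in> L_2s s" and s: "0 < s" and \<epsilon>: "0 < \<epsilon>"
  shows "integrable lebesgue (\<lambda>y. indicator (- ball x \<epsilon>) y * (u y / norm (x - y) powr (real CARD('n) + 2 * s)))"
proof -
  define q where "q = real CARD('n) + 2 * s"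
  have q: "0 < q" using s by (simp add: q_def add_nonneg_pos)
  define C where "C = \<epsilon> powr (- q) + (1 + norm x / \<epsilon>) powr q"
  have "integrable lebesgue (\<lambda>y. \<bar>u y\<bar> / (1 + norm y powr q))"
    using u by (simp add: L_2s_def q_def)
  then have i: "integrable lebesgue (\<lambda>y. C * (\<bar>u y\<bar> / (1 + norm y powr q)))"
    by (rule integrable_mult_right)
  show ?thesis
    unfolding q_def[symmetric]
  proof (rule Bochner_Integration.integrable_bound[OF i])
    have "u \<in> borel_measurable lebesgue" using u by (rule borel_measurable_L_2s)
    then show "(\<lambda>y. indicator (- ball x \<epsilon>) y * (u y / norm (x - y) powr q)) \<in> borel_measurable lebesgue"
      using lebesgue_measurable_norm_powr[of x q]
      by (intro borel_measurable_times borel_measurable_indicator borel_measurable_divide) auto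
    show "AE y in lebesgue. norm (indicator (- ball x \<epsilon>) y * (u y / norm (x - y) powr q))
        \<le> norm (C * (\<bar>u y\<bar> / (1 + norm y powr q)))"
    proof (intro AE_I2)
      fix y :: "real ^ 'n"
      define d where "d = norm (x - y)"
      have C: "0 \<le> C" by (simp add: C_def)
      have "\<bar>u y\<bar> / d powr q \<le> C * (\<bar>u y\<bar> / (1 + norm y powr q))" if "y \<in> - ball x \<epsilon>"
      proof -
        have d: "\<epsilon> \<le> d" "0 < d" using that \<epsilon> by (auto simp: d_def dist_norm)
        have "norm x * 1 \<le> norm x * (d / \<epsilon>)"
          using \<epsilon> d(1) by (intro mult_left_mono) auto
        then have "norm y \<le> d * (1 + norm x / \<epsilon>)"
          using norm_triangle_ineq4[of x "x - y"] by (simp add: d_def algebra_simps)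
        then have "norm y powr q \<le> (d * (1 + norm x / \<epsilon>)) powr q"
          using q by (intro powr_mono2) auto
        also have "\<dots> = d powr q * (1 + norm x / \<epsilon>) powr q"
          using d \<epsilon> by (simp add: powr_mult)
        finally have 1: "norm y powr q \<le> d powr q * (1 + norm x / \<epsilon>) powr q" .
        have "1 = \<epsilon> powr q * \<epsilon> powr (- q)" using \<epsilon> by (simp add: powr_minus)
        also have "\<dots> \<le> d powr q * \<epsilon> powr (- q)"
          using d \<epsilon> q by (intro mult_right_mono powr_mono2) auto
        finally have "1 + norm y powr q \<le> C * d powr q"
          using 1 by (simp add: C_def algebra_simps)
        then have "\<bar>u y\<bar> * (1 + norm y powr q) \<le> \<bar>u y\<bar> * (C * d powr q)"
          by (intro mult_left_mono) auto
        then show ?thesis using d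
          by (simp add: field_simps add_pos_nonneg)
      qed
      then show "norm (indicator (- ball x \<epsilon>) y * (u y / norm (x - y) powr q))
        \<le> norm (C * (\<bar>u y\<bar> / (1 + norm y powr q)))"
        using C by (auto simp: indicator_def d_def abs_mult)
    qed
  qed
qed

definition trunc_integral :: "real \<Rightarrow> (real ^ 'n \<Rightarrow> real) \<Rightarrow> real ^ 'n \<Rightarrow> real \<Rightarrow> real" where
  "trunc_integral s u x \<epsilon> = set_lebesgue_integral lebesgue (- ball x \<epsilon>)
        (\<lambda>y. (u x - u y) / norm (x - y) powr (real CARD('n) + 2 * s))"

text \<open>The linear term is odd about \<open>x\<close> and the kernel is even, so adding it on a ball changes nothing. Any linear
functional and any ball may be used: the differential of \<open>u\<close> on a small ball gives
convergence of the principal value, the slope of a touching paraboloid on a large ball gives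
its lower bound.\<close>

lemma trunc_integral_add_linear:
  fixes u l :: "real ^ 'n \<Rightarrow> real" and x :: "real ^ 'n" and s \<epsilon> \<rho> :: real
  defines "q \<equiv> real CARD('n) + 2 * s"
  assumes u: "u \<in> L_2s s" and s: "0 < s" and \<epsilon>: "0 < \<epsilon>" and l: "bounded_linear l"
  defines "g \<equiv> \<lambda>y. indicator (- ball x \<epsilon>) y *
      ((u x - u y + indicator (ball x \<rho>) y * l (y - x)) / norm (x - y) powr q)"
  shows "integrable lebesgue g" "trunc_integral s u x \<epsilon> = integral\<^sup>L lebesgue g"
proof -
  define A where "A = - ball x \<epsilon>"
  have q: "- q + real CARD('n) < 0" "0 < q" using s by (auto simp: q_def add_nonneg_pos)
  obtain K where K: "\<And>(x::real^'n) \<rho>. 0 < \<rho> \<Longrightarrow>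
      integrable lebesgue (\<lambda>y. indicator (- ball x \<rho>) y * norm (x - y) powr (- q))"
    using norm_powr_integral_outside_ball[where 'a="real^'n" and p="- q"] q by auto
  have k: "integrable lebesgue (\<lambda>y. indicator A y * norm (x - y) powr (- q))"
    unfolding A_def using \<epsilon> by (rule K)
  have iu: "integrable lebesgue (\<lambda>y. indicator A y * (u y / norm (x - y) powr q))"
    unfolding A_def q_def using u s \<epsilon> by (rule integrable_L_2s_div_norm_powr)
  have i1: "integrable lebesgue (\<lambda>y. indicator A y * ((u x - u y) / norm (x - y) powr q))"
  proof -
    have "integrable lebesgue (\<lambda>y. u x * (indicator A y * norm (x - y) powr (- q))
        - indicator A y * (u y / norm (x - y) powr q))"
      using k iu by (intro Bochner_Integration.integrable_diff integrable_mult_right)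
    then show ?thesis by (simp add: powr_minus divide_inverse algebra_simps)
  qed
  define w where "w y = indicator A y * (indicator (ball x \<rho>) y * l (y - x) / norm (x - y) powr q)" for y
  have lc: "continuous_on UNIV l" using l by (simp add: linear_continuous_on)
  have lm: "(\<lambda>y. l (y - x)) \<in> borel_measurable borel"
    by (intro borel_measurable_continuous_onI continuous_on_compose2[OF lc] continuous_intros) auto
  have wm: "w \<in> borel_measurable borel"
    unfolding w_def[abs_def] A_def
    by (intro borel_measurable_times borel_measurable_indicator borel_measurable_divide
        borel_measurable_norm_powr lm; simp)
  obtain B where B: "0 \<le> B" "\<And>z. norm (l z) \<le> norm z * B"
    using bounded_linear.nonneg_bounded[OF l] by blast
  have i2: "integrable lebesgue w"
  proof (rule Bochner_Integration.integrable_bound)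
    show "integrable lebesgue (\<lambda>y. (\<bar>\<rho>\<bar> * B) * (indicator A y * norm (x - y) powr (- q)))"
      using k by (rule integrable_mult_right)
    show "w \<in> borel_measurable lebesgue" using wm by (simp add: measurable_completion)
    have "norm (w y) \<le> norm (\<bar>\<rho>\<bar> * B * (indicator A y * norm (x - y) powr (- q)))" for y
    proof (cases "y \<in> A \<and> y \<in> ball x \<rho>")
      case True
      then have "norm (y - x) \<le> \<bar>\<rho>\<bar>" by (auto simp: dist_norm norm_minus_commute)
      then have "\<bar>l (y - x)\<bar> \<le> \<bar>\<rho>\<bar> * B"
        using B(2)[of "y - x"] mult_right_mono[OF _ B(1)] by fastforce
      then show ?thesis using True B(1)
        by (auto simp: w_def abs_mult powr_minus divide_inverse intro!: mult_right_mono)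
    qed (auto simp: w_def)
    then show "AE y in lebesgue. norm (w y) \<le> norm (\<bar>\<rho>\<bar> * B * (indicator A y * norm (x - y) powr (- q)))"
      by simp
  qed
  have w0: "integral\<^sup>L lebesgue w = 0"
  proof (rule integral_odd_about_eq_0[OF wm])
    fix y
    have n: "norm (x - (2 *\<^sub>R x - y)) = norm (x - y)"
      by (simp add: scaleR_2 norm_minus_commute)
    have "l (2 *\<^sub>R x - y - x) = - l (y - x)"
      using linear_neg[OF bounded_linear.linear[OF l], of "y - x"] by (simp add: scaleR_2)
    then show "w (2 *\<^sub>R x - y) = - w y"
      using n by (simp add: w_def A_def dist_norm indicator_def)
  qed
  have g: "g = (\<lambda>y. indicator A y * ((u x - u y) / norm (x - y) powr q) + w y)"
    by (auto simp: g_def w_def A_def fun_eq_iff add_divide_distrib distrib_left)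
  show "integrable lebesgue g" unfolding g using i1 i2 by simp
  show "trunc_integral s u x \<epsilon> = integral\<^sup>L lebesgue g"
    unfolding g using i1 i2 w0
    by (simp add: trunc_integral_def set_lebesgue_integral_def A_def q_def)
qed

lemma integral_minus_ball_tendsto:
  fixes h :: "real ^ 'n \<Rightarrow> real"
  assumes h: "integrable lebesgue h" and hx: "h x = 0"
  shows "((\<lambda>\<epsilon>. LINT y|lebesgue. indicator (- ball x \<epsilon>) y * h y) \<longlongrightarrow> integral\<^sup>L lebesgue h) (at_right 0)"
  unfolding filterlim_at_right_to_top
proof (rule integral_dominated_convergence_at_top[where w="\<lambda>y. norm (h y)"])
  show "integrable lebesgue (\<lambda>y. norm (h y))" using h by simp
  show hm: "h \<in> borel_measurable lebesgue" using h by simp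
  show "(\<lambda>y. indicator (- ball x (inverse t)) y * h y) \<in> borel_measurable lebesgue" for t :: real
    using hm by (intro borel_measurable_times borel_measurable_indicator) auto
  show "\<forall>\<^sub>F t in at_top. AE y in lebesgue. norm (indicator (- ball x (inverse t)) y * h y) \<le> norm (h y)"
    by (auto simp: indicator_def)
  show "AE y in lebesgue. ((\<lambda>t. indicator (- ball x (inverse t)) y * h y) \<longlongrightarrow> h y) at_top"
  proof (intro AE_I2 tendsto_eventually)
    fix y
    show "\<forall>\<^sub>F t in at_top. indicator (- ball x (inverse t)) y * h y = h y"
    proof (cases "y = x")
      case False
      have "\<forall>\<^sub>F t in at_top. inverse t < dist x y"
        using tendsto_inverse_0_at_top[OF filterlim_ident] False
        by (intro order_tendstoD) (auto simp: filterlim_ident)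
      then show ?thesis by eventually_elim auto
    qed (simp add: hx)
  qed
qed

text \<open>Once the linear part of \<open>u\<close> has been subtracted near \<open>x\<close>, the integrand is of order \<open>norm (x - y) powr (2 - n - 2 * s)\<close>, where
\<open>n\<close> is the dimension. This is integrable at \<open>x\<close> since \<open>s < 1\<close>, and dominated convergence applies.\<close>

lemma trunc_integral_convergent:
  fixes u :: "real ^ 'n \<Rightarrow> real"
  assumes u: "u \<in> L_2s s" and s: "0 < s" "s < 1" and l: "bounded_linear l" and r: "0 < r"
    and taylor: "\<And>y. y \<in> ball x r \<Longrightarrow> \<bar>u y - u x - l (y - x)\<bar> \<le> C * (norm (y - x))\<^sup>2"
  shows "\<exists>L. (trunc_integral s u x \<longlongrightarrow> L) (at_right 0)"
proof -
  define q where "q = real CARD('n) + 2 * s"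
  define h where "h y = (u x - u y + indicator (ball x r) y * l (y - x)) / norm (x - y) powr q" for y
  have um: "u \<in> borel_measurable lebesgue" using u by (rule borel_measurable_L_2s)
  have lc: "continuous_on UNIV l" using l by (simp add: linear_continuous_on)
  have lm: "(\<lambda>y. l (y - x)) \<in> borel_measurable lebesgue"
    by (intro measurable_completion, simp)
      (intro borel_measurable_continuous_onI continuous_on_compose2[OF lc] continuous_intros; simp)
  have hm: "h \<in> borel_measurable lebesgue"
    unfolding h_def[abs_def] using um lm lebesgue_measurable_norm_powr[of x q]
    by (intro borel_measurable_divide borel_measurable_add borel_measurable_diff borel_measurable_times borel_measurable_indicator) auto
  obtain K where K: "\<And>(x::real^'n) \<rho>. 0 < \<rho> \<Longrightarrow>
      integrable lebesgue (\<lambda>y. indicator (ball x \<rho>) y * norm (x - y) powr (2 - q))"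
    using norm_powr_integral_ball[where 'a="real^'n" and p="2 - q"] s by (auto simp: q_def)
  have near: "integrable lebesgue (\<lambda>y. indicator (ball x r) y * h y)"
  proof (rule Bochner_Integration.integrable_bound)
    show "integrable lebesgue (\<lambda>y. C * (indicator (ball x r) y * norm (x - y) powr (2 - q)))"
      using K[OF r] by (rule integrable_mult_right)
    show "(\<lambda>y. indicator (ball x r) y * h y) \<in> borel_measurable lebesgue"
      using hm by (intro borel_measurable_times borel_measurable_indicator) auto
    have "norm (indicator (ball x r) y * h y) \<le> norm (C * (indicator (ball x r) y * norm (x - y) powr (2 - q)))" for y
    proof (cases "y \<in> ball x r \<and> y \<noteq> x")
      case True
      then have "\<bar>u x - u y + l (y - x)\<bar> \<le> C * (norm (x - y))\<^sup>2"
        using taylor[of y] by (simp add: norm_minus_commute)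
      then have "\<bar>u x - u y + l (y - x)\<bar> / norm (x - y) powr q \<le> C * (norm (x - y))\<^sup>2 / norm (x - y) powr q"
        by (rule divide_right_mono) simp
      also have "\<dots> = C * norm (x - y) powr (2 - q)"
        using True by (simp add: powr_diff flip: powr_numeral)
      finally show ?thesis using True by (auto simp: h_def)
    qed (auto simp: h_def)
    then show "AE y in lebesgue. norm (indicator (ball x r) y * h y)
        \<le> norm (C * (indicator (ball x r) y * norm (x - y) powr (2 - q)))" by simp
  qed
  have "integrable lebesgue (\<lambda>y. indicator (- ball x r) y * h y)"
    unfolding h_def q_def using u s(1) r l by (rule trunc_integral_add_linear)
  with near have "integrable lebesgue (\<lambda>y. indicator (ball x r) y * h y + indicator (- ball x r) y * h y)"
    by simp
  also have "(\<lambda>y. indicator (ball x r) y * h y + indicator (- ball x r) y * h y) = h"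
    by (auto simp: indicator_def)
  finally have "((\<lambda>\<epsilon>. LINT y|lebesgue. indicator (- ball x \<epsilon>) y * h y) \<longlongrightarrow> integral\<^sup>L lebesgue h) (at_right 0)"
    by (rule integral_minus_ball_tendsto) (simp add: h_def)
  moreover have "\<forall>\<^sub>F \<epsilon> in at_right 0. (LINT y|lebesgue. indicator (- ball x \<epsilon>) y * h y) = trunc_integral s u x \<epsilon>"
    using eventually_at_right_less
    by eventually_elim (simp add: trunc_integral_add_linear(2)[OF u s(1) _ l, where \<rho>=r] h_def q_def)
  ultimately show ?thesis using Lim_transform_eventually by blast
qed

section \<open>Second-order bounds\<close>

text \<open>Differentiability of the differential at the single point \<open>x\<close> makes it Lipschitz at \<open>x\<close>, and the mean
value inequality turns this into a quadratic remainder.\<close>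

lemma C2_on_linear_approx:
  fixes u :: "real ^ 'n \<Rightarrow> real"
  assumes S: "open S" "x \<in> S" and u: "u \<in> C2_on S"
  obtains l r C where "bounded_linear l" "0 < r"
    "\<And>y. y \<in> ball x r \<Longrightarrow> \<bar>u y - u x - l (y - x)\<bar> \<le> C * (norm (y - x))\<^sup>2"
proof -
  from u obtain Du :: "real ^ 'n \<Rightarrow> (real ^ 'n) \<Rightarrow>\<^sub>L real"
    and D2u :: "real ^ 'n \<Rightarrow> (real ^ 'n) \<Rightarrow>\<^sub>L (real ^ 'n) \<Rightarrow>\<^sub>L real"
    where D1: "\<And>y. y \<in> S \<Longrightarrow> (u has_derivative blinfun_apply (Du y)) (at y)"
      and D2: "\<And>y. y \<in> S \<Longrightarrow> (Du has_derivative blinfun_apply (D2u y)) (at y)"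
    unfolding C2_on_def by blast
  define C where "C = 1 + norm (D2u x)"
  obtain d where d: "0 < d" "\<And>y. norm (y - x) < d \<Longrightarrow> norm (Du y - Du x - D2u x (y - x)) \<le> 1 * norm (y - x)"
    using D2[OF S(2)] unfolding has_derivative_at_alt by (metis zero_less_one)
  have lip: "norm (Du y - Du x) \<le> C * norm (y - x)" if "norm (y - x) < d" for y
  proof -
    have "norm (Du y - Du x) \<le> norm (Du y - Du x - D2u x (y - x)) + norm (D2u x (y - x))"
      using norm_triangle_ineq[of "Du y - Du x - D2u x (y - x)" "D2u x (y - x)"] by simp
    also have "\<dots> \<le> 1 * norm (y - x) + norm (D2u x) * norm (y - x)"
      using d(2)[OF that] norm_blinfun[of "D2u x" "y - x"] by linarith
    finally show ?thesis by (simp add: C_def algebra_simps)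
  qed
  obtain e where e: "0 < e" "ball x e \<subseteq> S" using S openE by blast
  define r where "r = min d e"
  have "\<bar>u y - u x - Du x (y - x)\<bar> \<le> C * (norm (y - x))\<^sup>2" if y: "y \<in> ball x r" for y
  proof -
    define T where "T = cball x (norm (y - x))"
    have T: "T \<subseteq> S" "\<And>z. z \<in> T \<Longrightarrow> norm (z - x) < d" "\<And>z. z \<in> T \<Longrightarrow> norm (z - x) \<le> norm (y - x)"
      using y e by (auto simp: T_def r_def dist_norm norm_minus_commute)
    have C: "0 \<le> C" by (simp add: C_def add_nonneg_nonneg)
    have "norm (u y - u x - Du x (y - x)) \<le> norm (y - x) * (C * norm (y - x))"
    proof (rule differentiable_bound_linearization)
      show "x + t *\<^sub>R (y - x) \<in> T" if "t \<in> {0..1}" for t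
        using that by (auto simp: T_def dist_norm mult_left_le_one_le)
      show "(u has_derivative blinfun_apply (Du z)) (at z within T)" if "z \<in> T" for z
        using D1 T(1) that by (blast intro: has_derivative_at_withinI)
      show "x \<in> T" by (simp add: T_def)
      show "onorm (blinfun_apply (Du z) - blinfun_apply (Du x)) \<le> C * norm (y - x)" if "z \<in> T" for z
      proof -
        have "onorm (blinfun_apply (Du z) - blinfun_apply (Du x)) = norm (Du z - Du x)"
          by (simp add: norm_blinfun.rep_eq minus_blinfun.rep_eq fun_diff_def)
        also have "\<dots> \<le> C * norm (z - x)" using lip T(2)[OF that] by blast
        also have "\<dots> \<le> C * norm (y - x)" using T(3)[OF that] C by (rule mult_left_mono)
        finally show ?thesis .
      qed
    qed
    then show ?thesis by (simp add: power2_eq_square mult_ac)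
  qed
  then show thesis
    using that[of "blinfun_apply (Du x)" r C] d e by (simp add: r_def blinfun.bounded_linear_right)
qed

text \<open>If the second derivative were larger, subtracting the parabola would leave a function with a maximum at \<open>0\<close>
whose derivative vanishes at \<open>0\<close> and is positive just to the right of it.\<close>

lemma second_deriv_le_at_touching_parabola:
  fixes g :: "real \<Rightarrow> real"
  assumes g1: "\<forall>\<^sub>F t in nhds 0. (g has_real_derivative g' t) (at t)"
    and g2: "(g' has_real_derivative D) (at 0)"
    and le: "\<forall>\<^sub>F t in nhds 0. g t \<le> g 0 + b * t + k * t\<^sup>2"
  shows "D \<le> 2 * k"
proof (rule ccontr)
  assume "\<not> D \<le> 2 * k"
  define f where "f t = g t - b * t - k * t\<^sup>2" for t
  define f' where "f' t = g' t - b - 2 * k * t" for t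
  have f': "(f has_real_derivative f' t) (at t)" if "(g has_real_derivative g' t) (at t)" for t
    unfolding f_def f'_def by (auto intro!: derivative_eq_intros that)
  have f2: "(f' has_real_derivative D - 2 * k) (at 0)"
    unfolding f'_def by (auto intro!: derivative_eq_intros g2)
  obtain d where d: "0 < d" "\<And>t. \<bar>t\<bar> < d \<Longrightarrow> (f has_real_derivative f' t) (at t) \<and> f t \<le> f 0"
  proof -
    from eventually_conj[OF g1 le] obtain d where "0 < d"
      "\<And>t. \<bar>t\<bar> < d \<Longrightarrow> (g has_real_derivative g' t) (at t) \<and> g t \<le> g 0 + b * t + k * t\<^sup>2"
      unfolding eventually_nhds_metric by (auto simp: dist_real_def)
    then show thesis using f' by (intro that[of d]) (auto simp: f_def algebra_simps)
  qed
  have "f' 0 = 0"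
    using d by (intro DERIV_local_max[of f "f' 0" 0 d]) auto
  moreover obtain e where e: "0 < e" "\<And>t. 0 < t \<Longrightarrow> t < e \<Longrightarrow> f' 0 < f' (0 + t)"
    using DERIV_pos_inc_right[OF f2] \<open>\<not> D \<le> 2 * k\<close> by auto
  ultimately have pos: "0 < f' t" if "0 < t" "t < e" for t using that by force
  define h where "h = min d e / 2"
  have h: "0 < h" "h < d" "h < e" using d(1) e(1) by (auto simp: h_def)
  have "f 0 < f h"
  proof (rule DERIV_pos_imp_increasing_open[OF h(1)])
    show "\<exists>y. (f has_real_derivative y) (at t) \<and> 0 < y" if "0 < t" "t < h" for t
      using d(2)[of t] pos[of t] that h by auto
    have "isCont f t" if "t \<in> {0..h}" for t
      using d(2)[of t] that h by (intro DERIV_isCont[of f "f' t"]) auto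
    then show "continuous_on {0..h} f" by (simp add: continuous_at_imp_continuous_on)
  qed
  then show False using d(2)[of h] h by auto
qed

lemma laplacian_le_at_touching_paraboloid:
  fixes u :: "real ^ 'n \<Rightarrow> real"
  assumes S: "open S" "x \<in> S" and u: "u \<in> C2_on S"
    and le: "\<forall>\<^sub>F y in nhds x. u y \<le> u x + b \<bullet> (y - x) + k * (norm (y - x))\<^sup>2"
  shows "laplacian u x \<le> 2 * k * real CARD('n)"
proof -
  from u obtain Du :: "real ^ 'n \<Rightarrow> (real ^ 'n) \<Rightarrow>\<^sub>L real"
    and D2u :: "real ^ 'n \<Rightarrow> (real ^ 'n) \<Rightarrow>\<^sub>L (real ^ 'n) \<Rightarrow>\<^sub>L real"
    where D1: "\<And>y. y \<in> S \<Longrightarrow> (u has_derivative blinfun_apply (Du y)) (at y)"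
      and D2: "\<And>y. y \<in> S \<Longrightarrow> (Du has_derivative blinfun_apply (D2u y)) (at y)"
    unfolding C2_on_def by blast
  have "partial_deriv i (partial_deriv i u) x \<le> 2 * k" for i
  proof -
    define e :: "real ^ 'n" where "e = axis i 1"
    have e: "norm e = 1" by (simp add: e_def)
    define \<gamma> where "\<gamma> t = x + t *\<^sub>R e" for t
    have \<gamma>: "(\<gamma> has_derivative (\<lambda>h. h *\<^sub>R e)) (at t)" for t
      unfolding \<gamma>_def[abs_def] by (auto intro!: derivative_eq_intros)
    have "isCont \<gamma> 0" by (simp add: \<gamma>_def[abs_def])
    then have lim: "filterlim \<gamma> (nhds x) (nhds 0)"
      using tendsto_at_iff_tendsto_nhds[of \<gamma> 0] by (simp add: isCont_def \<gamma>_def)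
    have near: "\<forall>\<^sub>F t in nhds 0. \<gamma> t \<in> S"
      using lim S by (rule topological_tendstoD)
    have d1: "((\<lambda>t. u (y + t *\<^sub>R e)) has_real_derivative Du y e) (at 0)" if "y \<in> S" for y
    proof -
      have "((\<lambda>t. u (y + t *\<^sub>R e)) has_derivative (\<lambda>h. Du y (h *\<^sub>R e))) (at 0)"
        using D1[OF that] by (intro has_derivative_compose[of "\<lambda>t. y + t *\<^sub>R e" "\<lambda>h. h *\<^sub>R e" 0 UNIV u])
          (auto intro!: derivative_eq_intros)
      then show ?thesis by (simp add: has_field_derivative_def blinfun.scaleR_right mult_commute_abs)
    qed
    then have p1: "partial_deriv i u y = Du y e" if "y \<in> S" for y
      using that by (simp add: partial_deriv_def e_def DERIV_imp_deriv)
    have d2: "((\<lambda>t. Du (\<gamma> t) e) has_real_derivative D2u x e e) (at 0)"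
    proof -
      have "(Du has_derivative blinfun_apply (D2u x)) (at (\<gamma> 0))"
        using D2[OF S(2)] by (simp add: \<gamma>_def)
      then have "((\<lambda>t. Du (\<gamma> t)) has_derivative (\<lambda>h. D2u x (h *\<^sub>R e))) (at 0)"
        using has_derivative_compose[OF \<gamma>] by blast
      then have "((\<lambda>t. Du (\<gamma> t) e) has_derivative (\<lambda>h. D2u x (h *\<^sub>R e) e)) (at 0)"
        by (auto intro!: derivative_eq_intros)
      then show ?thesis
        by (simp add: has_field_derivative_def blinfun.scaleR_right blinfun.scaleR_left mult_commute_abs)
    qed
    have "partial_deriv i (partial_deriv i u) x = deriv (\<lambda>t. partial_deriv i u (\<gamma> t)) 0"
      by (simp add: partial_deriv_def[of i "partial_deriv i u"] \<gamma>_def e_def)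
    also have "\<dots> = deriv (\<lambda>t. Du (\<gamma> t) e) 0"
      using near by (intro deriv_cong_ev) (auto elim!: eventually_mono simp: p1)
    also have "\<dots> = D2u x e e" using d2 by (rule DERIV_imp_deriv)
    also have "\<dots> \<le> 2 * k"
    proof (rule second_deriv_le_at_touching_parabola)
      show "((\<lambda>t. Du (\<gamma> t) e) has_real_derivative D2u x e e) (at 0)" by (rule d2)
      show "\<forall>\<^sub>F t in nhds 0. ((\<lambda>t. u (\<gamma> t)) has_real_derivative Du (\<gamma> t) e) (at t)"
        using near
      proof eventually_elim
        case (elim t)
        have "((\<lambda>t. u (\<gamma> t)) has_derivative (\<lambda>h. Du (\<gamma> t) (h *\<^sub>R e))) (at t)"
          using has_derivative_compose[OF \<gamma> D1[OF elim]] .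
        then show ?case by (simp add: has_field_derivative_def blinfun.scaleR_right mult_commute_abs)
      qed
      show "\<forall>\<^sub>F t in nhds 0. u (\<gamma> t) \<le> u (\<gamma> 0) + (b \<bullet> e) * t + k * t\<^sup>2"
      proof -
        have "\<forall>\<^sub>F t in nhds 0. u (\<gamma> t) \<le> u x + b \<bullet> (\<gamma> t - x) + k * (norm (\<gamma> t - x))\<^sup>2"
          using lim le by (auto simp: filterlim_iff)
        then show ?thesis by eventually_elim (simp add: \<gamma>_def e mult.commute)
      qed
    qed
    finally show ?thesis .
  qed
  then have "laplacian u x \<le> (\<Sum>i\<in>(UNIV :: 'n set). 2 * k)"
    unfolding laplacian_def by (intro sum_mono) auto
  then show ?thesis by (simp add: mult.commute)
qed

section \<open>A lower bound for truncated integrals at a touching point\<close>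

text \<open>Here \<open>u\<close> lies below a paraboloid of opening \<open>A / \<rho>\<^sup>2\<close> touching it at \<open>x\<close>, lies lower by a further \<open>m\<close> on \<open>E\<close>, and
exceeds \<open>u x\<close> by at most \<open>A\<close> outside the ball. Each of the three parts of the bound is homogeneous of
degree \<open>-2 * s\<close> in \<open>\<rho>\<close>: the quadratic loss \<open>A / \<rho>\<^sup>2\<close> meets an integral of size \<open>\<rho> powr (2 - 2 * s)\<close>, the loss \<open>A\<close>
meets one of size \<open>\<rho> powr (-2 * s)\<close>, and on \<open>E\<close> the kernel is at least \<open>\<rho> powr (- n - 2 * s)\<close>. The bound is
uniform in the truncation radius \<open>\<epsilon>\<close>, so it passes to the limit.\<close>

lemma trunc_integral_lower_bound:
  assumes s: "0 < s" "s < 1"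
  obtains K where "0 \<le> K"
    "\<And>(u :: real ^ 'n \<Rightarrow> real) x l \<rho> A m E \<epsilon>.
       \<lbrakk>u \<in> L_2s s; bounded_linear l; 0 < \<rho>; 0 \<le> A; 0 \<le> m; 0 < \<epsilon>;
        E \<in> sets lebesgue; E \<subseteq> ball x \<rho>; E \<inter> ball x \<epsilon> = {};
        \<And>y. y \<in> ball x \<rho> \<Longrightarrow> m * indicator E y - A / \<rho>\<^sup>2 * (norm (x - y))\<^sup>2 \<le> u x - u y + l (y - x);
        \<And>y. y \<notin> ball x \<rho> \<Longrightarrow> - A \<le> u x - u y\<rbrakk>
       \<Longrightarrow> \<rho> powr (- 2 * s) * (m * (measure lebesgue E / \<rho> ^ CARD('n)) - K * A) \<le> trunc_integral s u x \<epsilon>"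
proof -
  define q where "q = real CARD('n) + 2 * s"
  have q: "2 - q + real CARD('n) = 2 - 2 * s" "- q + real CARD('n) = - 2 * s" "0 < q"
    using s by (auto simp: q_def add_nonneg_pos)
  obtain K1 where K1: "0 \<le> K1"
    "\<And>(x::real^'n) \<rho>. 0 < \<rho> \<Longrightarrow> integrable lebesgue (\<lambda>y. indicator (ball x \<rho>) y * norm (x - y) powr (2 - q))"
    "\<And>(x::real^'n) \<rho>. 0 < \<rho> \<Longrightarrow> (LINT y|lebesgue. indicator (ball x \<rho>) y * norm (x - y) powr (2 - q))
        \<le> K1 * \<rho> powr (2 - 2 * s)"
    using norm_powr_integral_ball[where 'a="real^'n" and p="2 - q"] s q(1) by auto
  obtain K2 where K2: "0 \<le> K2"
    "\<And>(x::real^'n) \<rho>. 0 < \<rho> \<Longrightarrow> integrable lebesgue (\<lambda>y. indicator (- ball x \<rho>) y * norm (x - y) powr (- q))"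
    "\<And>(x::real^'n) \<rho>. 0 < \<rho> \<Longrightarrow> (LINT y|lebesgue. indicator (- ball x \<rho>) y * norm (x - y) powr (- q))
        \<le> K2 * \<rho> powr (- 2 * s)"
    using norm_powr_integral_outside_ball[where 'a="real^'n" and p="- q"] s q(2) by auto
  show thesis
  proof (rule that[of "K1 + K2"])
    show "0 \<le> K1 + K2" using K1(1) K2(1) by simp
    fix u l :: "real ^ 'n \<Rightarrow> real" and x \<rho> A m E \<epsilon>
    assume u: "u \<in> L_2s s" and l: "bounded_linear l" and \<rho>: "0 < \<rho>" and A: "0 \<le> A" and m: "0 \<le> m"
      and \<epsilon>: "0 < \<epsilon>" and E: "E \<in> sets lebesgue" "E \<subseteq> ball x \<rho>" "E \<inter> ball x \<epsilon> = {}"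
      and near: "\<And>y. y \<in> ball x \<rho> \<Longrightarrow> m * indicator E y - A / \<rho>\<^sup>2 * (norm (x - y))\<^sup>2 \<le> u x - u y + l (y - x)"
      and far: "\<And>y. y \<notin> ball x \<rho> \<Longrightarrow> - A \<le> u x - u y"
    define g where "g y = indicator (- ball x \<epsilon>) y *
      ((u x - u y + indicator (ball x \<rho>) y * l (y - x)) / norm (x - y) powr q)" for y
    have g: "integrable lebesgue g" "trunc_integral s u x \<epsilon> = integral\<^sup>L lebesgue g"
      unfolding g_def[abs_def] q_def by (rule trunc_integral_add_linear[OF u s(1) \<epsilon> l])+
    \<comment> \<open>A minorant of the integrand on the whole space; inside the removed ball it is nonpositive because
      \<open>E\<close> stays away.\<close>
    define v where "v y = m * \<rho> powr (- q) * indicator E y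
        - A / \<rho>\<^sup>2 * (indicator (ball x \<rho>) y * norm (x - y) powr (2 - q))
        - A * (indicator (- ball x \<rho>) y * norm (x - y) powr (- q))" for y
    have "E \<in> lmeasurable"
      using E(1,2) by (intro fmeasurableI2[OF lmeasurable_ball])
    then have iE: "integrable lebesgue (indicator E :: _ \<Rightarrow> real)" "integral\<^sup>L lebesgue (indicator E) = measure lebesgue E"
      by (auto simp: fmeasurable_def)
    have iv: "integrable lebesgue v"
      unfolding v_def[abs_def] using iE(1) K1(2)[OF \<rho>] K2(2)[OF \<rho>]
      by (intro Bochner_Integration.integrable_diff integrable_mult_right)
    have "integral\<^sup>L lebesgue v = m * \<rho> powr (- q) * measure lebesgue E
        - A / \<rho>\<^sup>2 * (LINT y|lebesgue. indicator (ball x \<rho>) y * norm (x - y) powr (2 - q))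
        - A * (LINT y|lebesgue. indicator (- ball x \<rho>) y * norm (x - y) powr (- q))"
      unfolding v_def[abs_def] using iE K1(2)[OF \<rho>, of x] K2(2)[OF \<rho>, of x]
      by (simp del: integral_mult_right_zero add: Bochner_Integration.integral_diff)
    moreover have "A / \<rho>\<^sup>2 * (LINT y|lebesgue. indicator (ball x \<rho>) y * norm (x - y) powr (2 - q))
        \<le> A / \<rho>\<^sup>2 * (K1 * \<rho> powr (2 - 2 * s))"
      using K1(3)[OF \<rho>] A by (intro mult_left_mono) auto
    moreover have "A * (LINT y|lebesgue. indicator (- ball x \<rho>) y * norm (x - y) powr (- q))
        \<le> A * (K2 * \<rho> powr (- 2 * s))"
      using K2(3)[OF \<rho>] A by (intro mult_left_mono) auto
    moreover have "\<rho> powr (2 - 2 * s) = \<rho>\<^sup>2 * \<rho> powr (- 2 * s)" "\<rho> powr (- q) = \<rho> powr (- 2 * s) / \<rho> ^ CARD('n)"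
      using \<rho> by (simp_all add: q_def powr_diff powr_minus powr_add powr_realpow field_simps)
    ultimately have "\<rho> powr (- 2 * s) * (m * (measure lebesgue E / \<rho> ^ CARD('n)) - (K1 + K2) * A)
        \<le> integral\<^sup>L lebesgue v"
      using \<rho> by (simp add: algebra_simps)
    also have "\<dots> \<le> integral\<^sup>L lebesgue g"
    proof (rule integral_mono[OF iv g(1)])
      fix y
      show "v y \<le> g y"
      proof (cases "y \<in> ball x \<epsilon>")
        case True
        then have "y \<notin> E" using E(3) by auto
        then show ?thesis using True A by (auto simp: v_def g_def indicator_def)
      next
        case out: False
        then have n: "0 < norm (x - y)" using \<epsilon> by auto
        show ?thesis
        proof (cases "y \<in> ball x \<rho>")
          case True
          have "\<rho> powr (- q) \<le> norm (x - y) powr (- q)"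
            using True q(3) n by (intro powr_mono2') (auto simp: dist_norm)
          then have "m * indicator E y * \<rho> powr (- q) \<le> m * indicator E y * norm (x - y) powr (- q)"
            using m by (intro mult_left_mono) auto
          then have "v y \<le> (m * indicator E y - A / \<rho>\<^sup>2 * (norm (x - y))\<^sup>2) * norm (x - y) powr (- q)"
            using True n by (simp add: v_def powr_diff powr_minus field_simps)
          also have "\<dots> \<le> (u x - u y + l (y - x)) * norm (x - y) powr (- q)"
            using near[OF True] by (rule mult_right_mono) simp
          also have "\<dots> = g y" using out True by (simp add: g_def powr_minus divide_inverse)
          finally show ?thesis .
        next
          case False
          then have "y \<notin> E" using E(2) by blast
          then have "v y = - A * norm (x - y) powr (- q)" using False by (simp add: v_def)
          also have "\<dots> \<le> (u x - u y) * norm (x - y) powr (- q)"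
            using far[OF False] by (rule mult_right_mono) simp
          also have "\<dots> = g y" using out False by (simp add: g_def powr_minus divide_inverse)
          finally show ?thesis .
        qed
      qed
    qed
    also have "\<dots> = trunc_integral s u x \<epsilon>" using g(2) by simp
    finally show "\<rho> powr (- 2 * s) * (m * (measure lebesgue E / \<rho> ^ CARD('n)) - (K1 + K2) * A)
        \<le> trunc_integral s u x \<epsilon>" .
  qed
qed

section \<open>An interior maximum by a small perturbation\<close>

text \<open>At a limit point outside \<open>\<Omega>\<close>, hence on its frontier, the boundary condition forces \<open>u < \<eta>\<close> nearby in \<open>\<Omega>\<close>.\<close>

lemma closed_positive_superlevel_set:
  fixes u :: "'a::metric_space \<Rightarrow> real"
  assumes \<Omega>: "open \<Omega>" and cont: "continuous_on \<Omega> u" and \<eta>: "0 < \<eta>"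
    and bd: "\<And>z. z \<in> frontier \<Omega> \<Longrightarrow> Limsup (at z within \<Omega>) (\<lambda>x. ereal (u x)) \<le> 0"
  shows "closed {y \<in> \<Omega>. \<eta> \<le> u y}"
  unfolding closed_limpt
proof (intro allI impI)
  fix z assume z: "z islimpt {y \<in> \<Omega>. \<eta> \<le> u y}"
  have freq: "\<exists>\<^sub>F y in at z. y \<in> \<Omega> \<and> \<eta> \<le> u y"
    using z by (simp add: islimpt_conv_frequently_at)
  show "z \<in> {y \<in> \<Omega>. \<eta> \<le> u y}"
  proof (cases "z \<in> \<Omega>")
    case True
    then have "u \<midarrow>z\<rightarrow> u z" using cont \<Omega> by (simp add: continuous_on_eq_continuous_at isCont_def)
    then have "\<forall>\<^sub>F y in at z. \<not> (y \<in> \<Omega> \<and> \<eta> \<le> u y)" if "u z < \<eta>"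
      using order_tendstoD(2)[OF _ that] by (force elim: eventually_mono)
    then have "\<not> u z < \<eta>" using freq by (auto simp: frequently_def)
    then show ?thesis using True by auto
  next
    case False
    have "z islimpt \<Omega>" using z by (rule islimpt_subset) auto
    then have "z \<in> frontier \<Omega>" using False \<Omega>
      by (simp add: frontier_def interior_open closure_def)
    then have "Limsup (at z within \<Omega>) (\<lambda>x. ereal (u x)) < ereal \<eta>"
      using bd \<eta> by (metis ereal_less(2) le_less_trans)
    then have "\<forall>\<^sub>F y in at z within \<Omega>. ereal (u y) < ereal \<eta>" by (rule Limsup_lessD)
    then have "\<forall>\<^sub>F y in at z. \<not> (y \<in> \<Omega> \<and> \<eta> \<le> u y)"
      unfolding eventually_at_filter by (auto elim!: eventually_mono)
    then show ?thesis using freq by (simp add: frequently_def)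
  qed
qed

text \<open>The perturbed function exceeds \<open>M\<close> at \<open>x0\<close>, whereas it is at most \<open>M\<close> outside the ball, where \<open>\<phi> = 0\<close>, and
also where \<open>u < M - a\<close>, since \<open>\<phi> \<le> 1\<close>. What remains is the part of a superlevel set in the ball, which
is compact and lies in \<open>\<Omega>\<close>, and on which the perturbed function is continuous.\<close>

lemma bump_perturbation_attains_max:
  fixes u :: "real ^ 'n \<Rightarrow> real" and x0 :: "real ^ 'n" and R a M :: real
  assumes \<phi>_def: "\<phi> = (\<lambda>y. max 0 (1 - (norm (y - x0))\<^sup>2 / R\<^sup>2))"
    and \<Omega>: "open \<Omega>" and cont: "continuous_on \<Omega> u"
    and bd: "\<And>z. z \<in> frontier \<Omega> \<Longrightarrow> Limsup (at z within \<Omega>) (\<lambda>x. ereal (u x)) \<le> 0"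
    and le0: "\<And>y. y \<notin> \<Omega> \<Longrightarrow> u y \<le> 0" and leM: "\<And>y. u y \<le> M"
    and a: "0 < a" "a < M" and R: "0 < R" and x0: "M - a < u x0"
  obtains x where "x \<in> \<Omega>" "norm (x - x0) < R" "M - a \<le> u x"
    "\<And>y. u y + a * \<phi> y \<le> u x + a * \<phi> x"
proof -
  define S where "S = {y \<in> \<Omega>. M - a \<le> u y} \<inter> cball x0 R"
  have x0S: "x0 \<in> S" using x0 a le0[of x0] R by (force simp: S_def)
  have "compact S"
    unfolding S_def using \<Omega> cont a bd
    by (intro closed_Int_compact closed_positive_superlevel_set compact_cball) auto
  moreover have "continuous_on S (\<lambda>y. u y + a * \<phi> y)"
  proof -
    have "continuous_on S u" using cont by (rule continuous_on_subset) (auto simp: S_def)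
    then show ?thesis unfolding \<phi>_def by (intro continuous_intros) (use R in auto)
  qed
  ultimately obtain x where x: "x \<in> S" "\<And>y. y \<in> S \<Longrightarrow> u y + a * \<phi> y \<le> u x + a * \<phi> x"
    using x0S continuous_attains_sup[of S "\<lambda>y. u y + a * \<phi> y"] by blast
  have "M < u x0 + a * \<phi> x0" using x0 by (simp add: \<phi>_def)
  also have "\<dots> \<le> u x + a * \<phi> x" using x0S by (rule x(2))
  finally have gt: "M < u x + a * \<phi> x" .
  have \<phi>1: "\<phi> y \<le> 1" for y by (simp add: \<phi>_def)
  have max: "u y + a * \<phi> y \<le> u x + a * \<phi> x" for y
  proof (cases "y \<in> S")
    case False
    have "u y + a * \<phi> y \<le> M"
    proof (cases "y \<in> cball x0 R")
      case True
      then have "u y < M - a" using False le0[of y] a by (force simp: S_def)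
      moreover have "a * \<phi> y \<le> a" using \<phi>1 a by (simp add: mult_left_le)
      ultimately show ?thesis by linarith
    next
      case False
      then have "R\<^sup>2 \<le> (norm (y - x0))\<^sup>2"
        using R by (intro power_mono) (auto simp: dist_norm norm_minus_commute)
      then have "\<phi> y = 0" using R by (simp add: \<phi>_def)
      then show ?thesis using leM by simp
    qed
    then show ?thesis using gt by simp
  qed (rule x(2))
  have "0 < \<phi> x" using gt leM[of x] a(1) by (smt (verit) zero_less_mult_pos)
  then have "(norm (x - x0))\<^sup>2 < R\<^sup>2" using R by (simp add: \<phi>_def max_def split: if_splits)
  then have "norm (x - x0) < R" using R power2_less_imp_less[of "norm (x - x0)" R] by simp
  then show thesis using that[OF _ _ _ max] x(1) by (auto simp: S_def)
qed

section \<open>The maximum principle\<close>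

lemma frac_const_pos: "0 < s \<Longrightarrow> s < 1 \<Longrightarrow> 0 < frac_const n s"
  unfolding frac_const_def
  by (intro divide_pos_pos mult_pos_pos Gamma_real_pos) (auto intro: add_nonneg_pos)

lemma density_at_some_large_radius:
  assumes "ereal c0 \<le> Liminf at_top (\<lambda>R. ereal (f R / g R))" and "c < c0"
  obtains R :: real where "r \<le> R" "c < f R / g R"
proof -
  have "ereal c < Liminf at_top (\<lambda>R. ereal (f R / g R))"
    using assms(2) by (intro less_le_trans[OF _ assms(1)]) simp
  then have "\<forall>\<^sub>F R in at_top. ereal c < ereal (f R / g R)" by (rule less_LiminfD)
  from eventually_conj[OF this eventually_ge_at_top[of r]] show thesis
    using that by (auto dest: eventually_happens)
qed

theorem theorem1p3:
  fixes s c0 :: real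
    and \<Omega> :: "(real ^ 'n) set"
    and u c :: "real ^ 'n \<Rightarrow> real"
  assumes "0 < s" and "s < 1"
    and "open \<Omega>"
    and "c0 > 0"
    and "\<forall>x0. Liminf at_top (\<lambda>R. ereal (measure lebesgue (ball x0 R \<inter> - \<Omega>)
                                         / measure lebesgue (ball x0 R))) \<ge> ereal c0"
    and "u \<in> L_2s s \<inter> C2_on \<Omega>"
    and "bdd_above (range u)"
    and "\<forall>x\<in>\<Omega>. c x \<ge> 0"
    and "\<forall>x\<in>\<Omega>. u x > 0 \<longrightarrow> frac_laplacian s u x - laplacian u x + c x * u x \<le> 0"
    and "\<forall>x\<in>- \<Omega>. u x \<le> 0"
    \<comment> \<open>the exterior condition is attained from inside; without this the claim is false\<close>
    and "\<forall>z\<in>frontier \<Omega>. Limsup (at z within \<Omega>) (\<lambda>x. ereal (u x)) \<le> 0"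
  shows "\<forall>x\<in>\<Omega>. u x \<le> 0"
proof (rule ccontr)
  assume "\<not> (\<forall>x\<in>\<Omega>. u x \<le> 0)"
  then obtain x1 where x1: "0 < u x1" by (auto simp: not_le)
  define M where "M = (SUP x. u x)"
  have leM: "u y \<le> M" for y
    unfolding M_def using assms(7) by (intro cSUP_upper) auto
  have M: "0 < M" using x1 leM[of x1] by simp
  have u: "u \<in> L_2s s" "u \<in> C2_on \<Omega>" using assms(6) by auto
  have cont: "continuous_on \<Omega> u"
    using u(2) unfolding C2_on_def
    by (blast intro: continuous_at_imp_continuous_on has_derivative_continuous)
  define n where "n = real CARD('n)"
  define F where "F = frac_const CARD('n) s"
  define V where "V = unit_ball_vol n"
  have n: "0 < n" and F: "0 < F" and V: "0 < V"
    using assms(1,2) by (auto simp: n_def F_def V_def frac_const_pos)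
  obtain K where K: "0 \<le> K"
    "\<And>(u :: real ^ 'n \<Rightarrow> real) x l \<rho> A m E \<epsilon>.
       \<lbrakk>u \<in> L_2s s; bounded_linear l; 0 < \<rho>; 0 \<le> A; 0 \<le> m; 0 < \<epsilon>;
        E \<in> sets lebesgue; E \<subseteq> ball x \<rho>; E \<inter> ball x \<epsilon> = {};
        \<And>y. y \<in> ball x \<rho> \<Longrightarrow> m * indicator E y - A / \<rho>\<^sup>2 * (norm (x - y))\<^sup>2 \<le> u x - u y + l (y - x);
        \<And>y. y \<notin> ball x \<rho> \<Longrightarrow> - A \<le> u x - u y\<rbrakk>
       \<Longrightarrow> \<rho> powr (- 2 * s) * (m * (measure lebesgue E / \<rho> ^ CARD('n)) - K * A) \<le> trunc_integral s u x \<epsilon>"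
    by (fact trunc_integral_lower_bound[OF assms(1,2), where 'n='n])
  \<comment> \<open>\<open>M * \<kappa>\<close> is the gain from \<open>- \<Omega>\<close> without its factor \<open>\<rho> powr (-2 * s)\<close>: half of \<open>M\<close>, times the density
    \<open>c0 / 2\<close>, times the volume of \<open>ball x0 R\<close> relative to \<open>\<rho> ^ n\<close>, with \<open>\<rho> = 2 * R\<close>. The choice of \<open>\<delta>\<close>
    makes the total loss at most half of the gain.\<close>
  define \<kappa> where "\<kappa> = c0 * V / (4 * 2 ^ CARD('n))"
  have \<kappa>: "0 < \<kappa>" using assms(4) V by (simp add: \<kappa>_def)
  define \<delta> where "\<delta> = min (1/4) (F * \<kappa> / (2 * (4 * F * K + 8 * n)))"
  have D: "0 < 4 * F * K + 8 * n" using F K(1) n by (simp add: add_nonneg_pos)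
  have \<delta>: "0 < \<delta>" "\<delta> \<le> 1/4"
    using F \<kappa> D unfolding \<delta>_def by (simp, intro min.cobounded1)
  have "\<delta> \<le> F * \<kappa> / (2 * (4 * F * K + 8 * n))" by (simp add: \<delta>_def)
  then have "\<delta> * (4 * F * K + 8 * n) \<le> F * \<kappa> / 2" using D by (simp add: field_simps)
  also have "\<dots> < F * \<kappa>" using F \<kappa> by simp
  finally have \<delta>_small: "\<delta> * (4 * F * K + 8 * n) < F * \<kappa>" .
  define a where "a = \<delta> * M"
  have a: "0 < a" "4 * a \<le> M" using \<delta> M by (auto simp: a_def)
  have "\<exists>x0\<in>UNIV. M - a < u x0"
    using a(1) assms(7) unfolding M_def by (subst less_cSUP_iff[symmetric]) auto
  then obtain x0 where x0: "M - a < u x0" by blast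
  obtain R where R: "1 \<le> R" and dens: "c0 / 2 < measure lebesgue (ball x0 R \<inter> - \<Omega>) / measure lebesgue (ball x0 R)"
    using density_at_some_large_radius[OF assms(5)[rule_format, of x0], of "c0 / 2" 1] assms(4) by auto
  define \<phi> where "\<phi> = (\<lambda>y. max 0 (1 - (norm (y - x0))\<^sup>2 / R\<^sup>2))"
  obtain x where x: "x \<in> \<Omega>" "norm (x - x0) < R" "M - a \<le> u x"
    and max: "\<And>y. u y + a * \<phi> y \<le> u x + a * \<phi> x"
  proof (rule bump_perturbation_attains_max[OF \<phi>_def assms(3) cont _ _ leM a(1) _ _ x0])
    show "Limsup (at z within \<Omega>) (\<lambda>x. ereal (u x)) \<le> 0" if "z \<in> frontier \<Omega>" for z
      using assms(11) that by blast
    show "u y \<le> 0" if "y \<notin> \<Omega>" for y using assms(10) that by simp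
    show "a < M" "0 < R" using a M R by auto
  qed blast
  have phi: "\<phi> x = 1 - (norm (x - x0))\<^sup>2 / R\<^sup>2"
  proof -
    have "(norm (x - x0))\<^sup>2 \<le> R\<^sup>2" using x(2) by (intro power_mono) auto
    then show ?thesis using R by (auto simp: \<phi>_def)
  qed
  define b where "b = (2 * a / R\<^sup>2) *\<^sub>R (x - x0)"
  \<comment> \<open>The paraboloid \<open>1 - |y - x0|\<^sup>2 / R\<^sup>2\<close>, centred at \<open>x0\<close>, rewritten around \<open>x\<close>.\<close>
  have expand: "a / R\<^sup>2 * ((norm (y - x0))\<^sup>2 - (norm (x - x0))\<^sup>2) = b \<bullet> (y - x) + a / R\<^sup>2 * (norm (y - x))\<^sup>2" for y
  proof -
    have "(norm (y - x0))\<^sup>2 - (norm (x - x0))\<^sup>2 = 2 * ((x - x0) \<bullet> (y - x)) + (norm (y - x))\<^sup>2"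
      by (simp add: power2_norm_eq_inner inner_diff inner_commute algebra_simps)
    then show ?thesis by (simp only: b_def inner_scaleR_left) (simp add: distrib_left)
  qed
  have paraboloid: "u y \<le> u x + b \<bullet> (y - x) + a / R\<^sup>2 * (norm (y - x))\<^sup>2" for y
  proof -
    \<comment> \<open>The inequality holds for all \<open>y\<close>, beyond the support of \<open>\<phi>\<close> too, because \<open>\<phi>\<close> is a maximum of functions.\<close>
    have "a * (1 - (norm (y - x0))\<^sup>2 / R\<^sup>2) \<le> a * \<phi> y"
      using a by (intro mult_left_mono) (auto simp: \<phi>_def)
    then have "u y \<le> u x + a * \<phi> x - a * (1 - (norm (y - x0))\<^sup>2 / R\<^sup>2)" using max[of y] by linarith
    also have "\<dots> = u x + a / R\<^sup>2 * ((norm (y - x0))\<^sup>2 - (norm (x - x0))\<^sup>2)"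
      by (simp add: phi algebra_simps diff_divide_distrib)
    finally show ?thesis by (simp only: expand add.assoc)
  qed
  \<comment> \<open>Twice the radius, so that the ball around \<open>x\<close> contains \<open>ball x0 R\<close>.\<close>
  define \<rho> where "\<rho> = 2 * R"
  have \<rho>: "1 \<le> \<rho>" "0 < \<rho>" using R by (auto simp: \<rho>_def)
  have lap: "laplacian u x \<le> \<rho> powr (- 2 * s) * (8 * a * n)"
  proof -
    have "laplacian u x \<le> 2 * (a / R\<^sup>2) * real CARD('n)"
      using paraboloid by (intro laplacian_le_at_touching_paraboloid[OF assms(3) x(1) u(2), of b]) auto
    also have "\<dots> = \<rho> powr (- 2) * (8 * a * n)"
      using R by (simp add: \<rho>_def n_def powr_minus field_simps)
    also have "\<dots> \<le> \<rho> powr (- 2 * s) * (8 * a * n)"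
      using \<rho> assms(2) a n by (intro mult_right_mono powr_mono) auto
    finally show ?thesis .
  qed
  define E where "E = ball x0 R \<inter> - \<Omega>"
  have E_sub: "E \<subseteq> ball x \<rho>"
  proof
    fix y assume "y \<in> E"
    then have "dist x0 y < R" by (simp add: E_def)
    moreover have "dist x x0 < R" using x(2) by (simp add: dist_norm)
    ultimately show "y \<in> ball x \<rho>" using dist_triangle[of x y x0] by (simp add: \<rho>_def)
  qed
  have E_meas: "c0 / 2 * V / 2 ^ CARD('n) \<le> measure lebesgue E / \<rho> ^ CARD('n)"
  proof -
    have ball: "measure lebesgue (ball x0 R) = V * R ^ CARD('n)"
      using R by (simp add: content_ball V_def n_def)
    then have "c0 / 2 * (V * R ^ CARD('n)) \<le> measure lebesgue E"
      using dens R V by (simp add: E_def field_simps)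
    then show ?thesis using R by (simp add: \<rho>_def power_mult_distrib field_simps)
  qed
  \<comment> \<open>On \<open>E\<close> the difference \<open>u x - u y\<close> is at least \<open>M - a\<close>, and the paraboloid uses up at most \<open>a\<close> of it;
    \<open>4 * a \<le> M\<close> leaves \<open>M / 2\<close>.\<close>
  have near: "M / 2 * indicator E y - (4 * a) / \<rho>\<^sup>2 * (norm (x - y))\<^sup>2 \<le> u x - u y + b \<bullet> (y - x)" for y
  proof (cases "y \<in> E")
    case True
    have "(a / R\<^sup>2) * (norm (y - x0))\<^sup>2 \<ge> 0" using a by simp
    moreover have "a * \<phi> x \<ge> 0" using a by (simp add: \<phi>_def)
    ultimately have "- a \<le> a / R\<^sup>2 * ((norm (y - x0))\<^sup>2 - (norm (x - x0))\<^sup>2)"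
      by (simp add: phi algebra_simps)
    then have "- a \<le> b \<bullet> (y - x) + a / R\<^sup>2 * (norm (y - x))\<^sup>2" by (simp only: expand)
    moreover have "u y \<le> 0" using True assms(10) by (auto simp: E_def)
    ultimately show ?thesis
      using True x(3) a by (simp add: \<rho>_def power_mult_distrib norm_minus_commute)
  next
    case False
    then show ?thesis using paraboloid[of y] by (simp add: \<rho>_def power_mult_distrib norm_minus_commute)
  qed
  have far: "- (4 * a) \<le> u x - u y" for y
    using x(3) leM[of y] a by linarith
  define B where "B = \<rho> powr (- 2 * s) * (M * \<kappa> - K * (4 * a))"
  have lower: "B \<le> trunc_integral s u x \<epsilon>" if "0 < \<epsilon>" "ball x \<epsilon> \<subseteq> \<Omega>" for \<epsilon>
  proof -
    have "M / 2 * (c0 / 2 * V / 2 ^ CARD('n)) \<le> M / 2 * (measure lebesgue E / \<rho> ^ CARD('n))"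
      using E_meas M by (intro mult_left_mono) auto
    then have "B \<le> \<rho> powr (- 2 * s) * (M / 2 * (measure lebesgue E / \<rho> ^ CARD('n)) - K * (4 * a))"
      unfolding B_def by (intro mult_left_mono) (auto simp: \<kappa>_def field_simps)
    also have "\<dots> \<le> trunc_integral s u x \<epsilon>"
    proof (rule K(2)[where l="\<lambda>z. b \<bullet> z" and E=E])
      show "E \<in> sets lebesgue" unfolding E_def using assms(3)
        by (intro sets.Int sets.compl_sets sets_completionI_sets) (auto intro: borel_closed)
      show "E \<inter> ball x \<epsilon> = {}" using that by (auto simp: E_def)
    qed (use u(1) \<rho>(2) a M that E_sub near far in \<open>auto intro: bounded_linear_inner_right\<close>)
    finally show ?thesis .
  qed
  obtain l r C where l: "bounded_linear l" "0 < r"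
    "\<And>y. y \<in> ball x r \<Longrightarrow> \<bar>u y - u x - l (y - x)\<bar> \<le> C * (norm (y - x))\<^sup>2"
    using C2_on_linear_approx[OF assms(3) x(1) u(2)] by blast
  obtain L where L: "(trunc_integral s u x \<longlongrightarrow> L) (at_right 0)"
    using trunc_integral_convergent[OF u(1) assms(1,2) l] by blast
  have "frac_laplacian s u x = F * L"
    using tendsto_Lim[OF _ L] by (simp add: frac_laplacian_def F_def trunc_integral_def[abs_def])
  moreover have "B \<le> L"
  proof (rule tendsto_lowerbound[OF L])
    obtain e where e: "0 < e" "ball x e \<subseteq> \<Omega>" using assms(3) x(1) openE by blast
    then have "\<forall>\<^sub>F \<epsilon> in at_right 0. \<epsilon> \<in> {0<..<e}" by (intro eventually_at_right_real)
    then show "\<forall>\<^sub>F \<epsilon> in at_right 0. B \<le> trunc_integral s u x \<epsilon>"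
      by eventually_elim (use e in \<open>auto intro!: lower dest: subsetD[OF subset_ball]\<close>)
  qed simp
  moreover have "0 < u x" using x(3) a M by linarith
  moreover have "0 \<le> c x * u x" using assms(8) x(1) \<open>0 < u x\<close> by simp
  ultimately have "F * L \<le> laplacian u x" "F * B \<le> F * L"
    using assms(9)[rule_format, of x] x(1) F by auto
  then have "\<rho> powr (- 2 * s) * (F * (M * \<kappa> - K * (4 * a))) \<le> \<rho> powr (- 2 * s) * (8 * a * n)"
    using lap by (simp add: B_def mult_ac)
  then have "F * (M * \<kappa> - K * (4 * a)) \<le> 8 * a * n" using \<rho> by simp
  then have "M * (F * \<kappa>) \<le> M * (\<delta> * (4 * F * K + 8 * n))" by (simp add: a_def algebra_simps)
  then show False using M \<delta>_small by simp
qed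

end
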